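(* Let $\delta>0$ be any real number, let $P_\delta:=[0,2\pi)\times[-\delta,\delta]$, and let $$\mathbf{w}(t,r):=\big(\cos t+r\cos\tfrac t2,\ \sin t+r\sin\tfrac t2,\ r\sin\tfrac t2\big)\in\mathbb{R}^3\quad\text{for }(t,r)\in P_\delta.$$ Then $$\mathbf{w}(P_\delta)=G(f)\cup\{(-1,0,z)\colon z\in\mathbb{R},\ |z|\le\sigma_\delta\},$$ where $G(f)$ and $\sigma_\delta$ are as defined in the context.
   Context: Put $$S_\delta:=\big\{(x,y)\in\mathbb{R}^2\setminus\{(-1,0)\}\colon g(x,y)\le\delta^2\big\},\qquad g(x,y):=\frac{(x^2+y^2-1)^2}{(x+1)^2+y^2},$$ $$f(x,y):=y-\frac{2(x+1)y}{(x+1)^2+y^2}=y\,\frac{x^2+y^2-1}{(x+1)^2+y^2}\quad\text{for }(x,y)\in S_\delta,$$ and let $G(f):=\{(x,y,f(x,y))\colon(x,y)\in S_\delta\}$ be the graph of $f$. Also put $b_\delta:=\tfrac12\min(\delta,\sqrt2)$ and $\sigma_\delta:=2b_\delta\sqrt{1-b_\delta^2}$. *)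

theory Defs
  imports Complex_Main
begin

definition g :: "real \<times> real \<Rightarrow> real" where
  "g = (\<lambda>(x, y). (x\<^sup>2 + y\<^sup>2 - 1)\<^sup>2 / ((x + 1)\<^sup>2 + y\<^sup>2))"

definition S :: "real \<Rightarrow> (real \<times> real) set" where
  "S \<delta> = {p \<in> UNIV - {(-1, 0)}. g p \<le> \<delta>\<^sup>2}"

(* f is a total function here; only its values on S \<delta>, where the denominator is positive,
   are ever used (see graph_f). *)
definition f :: "real \<times> real \<Rightarrow> real" where
  "f = (\<lambda>(x, y). y - 2 * (x + 1) * y / ((x + 1)\<^sup>2 + y\<^sup>2))"

lemma f_alt:
  assumes "(x, y) \<noteq> (-1, 0)"
  shows "f (x, y) = y * ((x\<^sup>2 + y\<^sup>2 - 1) / ((x + 1)\<^sup>2 + y\<^sup>2))"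
proof -
  have "(x + 1)\<^sup>2 + y\<^sup>2 \<noteq> 0"
    using assms by (auto simp: sum_power2_eq_zero_iff)
  then show ?thesis
    by (simp add: f_def divide_simps) (simp add: power2_eq_square algebra_simps)
qed

definition graph_f :: "real \<Rightarrow> (real \<times> real \<times> real) set" where
  "graph_f \<delta> = {(x, y, f (x, y)) | x y. (x, y) \<in> S \<delta>}"

definition b :: "real \<Rightarrow> real" where
  "b \<delta> = 1 / 2 * min \<delta> (sqrt 2)"

definition \<sigma> :: "real \<Rightarrow> real" where
  "\<sigma> \<delta> = 2 * b \<delta> * sqrt (1 - (b \<delta>)\<^sup>2)"

definition P :: "real \<Rightarrow> (real \<times> real) set" where
  "P \<delta> = {0..<2 * pi} \<times> {-\<delta>..\<delta>}"

definition w :: "real \<times> real \<Rightarrow> real \<times> real \<times> real" where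
  "w = (\<lambda>(t, r). (cos t + r * cos (t / 2), sin t + r * sin (t / 2), r * sin (t / 2)))"

end

theory Submission imports Defs
begin

text \<open>With \<open>c = cos (t/2)\<close>, \<open>s = sin (t/2)\<close> and \<open>q = 2 c + r\<close> the map \<open>w\<close> reads
  \<open>(x + 1, y) = q (c, s)\<close>, \<open>z = r s\<close>. Hence \<open>(x + 1)\<^sup>2 + y\<^sup>2 = q\<^sup>2\<close> and
  \<open>x\<^sup>2 + y\<^sup>2 - 1 = q r\<close>, so that \<open>g = r\<^sup>2\<close> and \<open>f = r s\<close> whenever \<open>q \<noteq> 0\<close>; conversely
  \<open>q\<close> is recovered from \<open>(x, y) \<noteq> (-1, 0)\<close> as the signed distance to \<open>(-1, 0)\<close>. The
  points with \<open>q = 0\<close> are \<open>(-1, 0, -2 c s)\<close> with \<open>2 \<bar>c\<bar> \<le> \<delta>\<close>, and \<open>(2 c s)\<^sup>2 = 4 c\<^sup>2 (1 - c\<^sup>2)\<close>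
  is increasing in \<open>c\<^sup>2\<close> up to \<open>c\<^sup>2 = 1/2\<close>.\<close>

text \<open>Take \<open>t = 2 * arccos c\<close>; excluding \<open>c = -1\<close> is what keeps
  \<open>t\<close> strictly below \<open>2 * pi\<close>.\<close>

lemma half_angle_surj:
  fixes c s :: real
  assumes "c\<^sup>2 + s\<^sup>2 = 1" "0 \<le> s" "c \<noteq> -1"
  obtains t where "t \<in> {0..<2 * pi}" "cos (t / 2) = c" "sin (t / 2) = s"
proof -
  have c: "-1 \<le> c" "c \<le> 1"
    using assms(1) abs_le_square_iff[of c 1] zero_le_power2[of s] by auto
  then have "arccos c < pi" "0 \<le> arccos c"
    using assms(3) arccos_less_arccos[of "-1" c] arccos_lbound by auto
  moreover have "sin (arccos c) = s"
    using c assms(1,2) by (simp add: sin_arccos real_sqrt_unique)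
  ultimately show thesis
    using c by (intro that[of "2 * arccos c"]) auto
qed

lemma w_half_angle:
  assumes "cos (t / 2) = c" "sin (t / 2) = s"
  shows "w (t, r) = (c * (2 * c + r) - 1, s * (2 * c + r), r * s)"
proof -
  have "cos t = 2 * c\<^sup>2 - 1" "sin t = 2 * s * c"
    using cos_double_cos[of "t / 2"] sin_double[of "t / 2"] assms by auto
  then show ?thesis
    by (simp add: w_def assms power2_eq_square algebra_simps)
qed

text \<open>Trades the angle for the direction \<open>(c, s)\<close>. As \<open>t / 2\<close> runs
  through [0, pi), this covers the closed upper half circle without its left endpoint.\<close>

lemma w_image:
  "w ` P \<delta> = {(c * (2 * c + r) - 1, s * (2 * c + r), r * s) | c s r.
     c\<^sup>2 + s\<^sup>2 = 1 \<and> 0 \<le> s \<and> c \<noteq> -1 \<and> \<bar>r\<bar> \<le> \<delta>}" (is "_ = ?R")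
proof (intro equalityI subsetI)
  fix p assume "p \<in> w ` P \<delta>"
  then obtain t r where p: "p = w (t, r)" and t: "0 \<le> t" "t < 2 * pi" and r: "\<bar>r\<bar> \<le> \<delta>"
    by (auto simp: P_def)
  have "cos (t / 2) \<noteq> -1" "0 \<le> sin (t / 2)"
    using t cos_monotone_0_pi[of "t / 2" pi] by (auto intro: sin_ge_zero)
  moreover have "(cos (t / 2))\<^sup>2 + (sin (t / 2))\<^sup>2 = 1"
    by simp
  ultimately show "p \<in> ?R"
    unfolding p w_half_angle[OF refl refl] using r by blast
next
  fix p assume "p \<in> ?R"
  then obtain c s r where p: "p = (c * (2 * c + r) - 1, s * (2 * c + r), r * s)"
    and cs: "c\<^sup>2 + s\<^sup>2 = 1" "0 \<le> s" "c \<noteq> -1" and r: "\<bar>r\<bar> \<le> \<delta>"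
    by blast
  obtain t where "t \<in> {0..<2 * pi}" "cos (t / 2) = c" "sin (t / 2) = s"
    using half_angle_surj[OF cs] .
  then show "p \<in> w ` P \<delta>"
    using r by (auto simp: P_def p w_half_angle intro!: image_eqI[of _ _ "(t, r)"])
qed

lemma polar_g_f:
  fixes c s q :: real
  assumes "c\<^sup>2 + s\<^sup>2 = 1" "q \<noteq> 0"
  shows "(c * q - 1, s * q) \<noteq> (-1, 0)"
    and "g (c * q - 1, s * q) = (q - 2 * c)\<^sup>2"
    and "f (c * q - 1, s * q) = (q - 2 * c) * s"
proof -
  show ne: "(c * q - 1, s * q) \<noteq> (-1, 0)"
    using assms by auto
  have D: "(c * q - 1 + 1)\<^sup>2 + (s * q)\<^sup>2 = q\<^sup>2"
    using assms(1) by (simp add: power_mult_distrib flip: distrib_right)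
  \<comment> \<open>In general \<open>x\<^sup>2 + y\<^sup>2 - 1\<close> equals
    \<open>(x + 1)\<^sup>2 + y\<^sup>2 - 2 * (x + 1)\<close>, here
    \<open>q\<^sup>2 - 2 * c * q\<close>.\<close>
  have N: "(c * q - 1)\<^sup>2 + (s * q)\<^sup>2 - 1 = q * (q - 2 * c)"
    using D by (simp add: power2_eq_square algebra_simps)
  show "g (c * q - 1, s * q) = (q - 2 * c)\<^sup>2"
    unfolding g_def prod.case D N using assms(2) by (simp add: power_mult_distrib)
  show "f (c * q - 1, s * q) = (q - 2 * c) * s"
    unfolding f_alt[OF ne] D N using assms(2) by (simp add: power2_eq_square)
qed

lemma polar_exists:
  fixes x y :: real
  assumes "(x, y) \<noteq> (-1, 0)"
  obtains c s q where "c\<^sup>2 + s\<^sup>2 = 1" "0 \<le> s" "c \<noteq> -1" "q \<noteq> 0"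
    "x = c * q - 1" "y = s * q"
proof -
  define d where "d = sqrt ((x + 1)\<^sup>2 + y\<^sup>2)"
  \<comment> \<open>Each line through (-1, 0) has exactly one admissible direction. The sign of
    \<open>q\<close> selects it: negative below the axis, to get \<open>s\<close> \<ge> 0, and on
    the ray left of (-1, 0), to avoid \<open>c = -1\<close>.\<close>
  define q where "q = (if y < 0 \<or> y = 0 \<and> x < -1 then - d else d)"
  have D: "0 < (x + 1)\<^sup>2 + y\<^sup>2"
    using assms by (auto simp: sum_power2_gt_zero_iff)
  then have d: "0 < d"
    by (simp add: d_def)
  have q2: "q\<^sup>2 = (x + 1)\<^sup>2 + y\<^sup>2"
    using D by (auto simp: q_def d_def)
  have q0: "q \<noteq> 0"
    using d by (auto simp: q_def)
  have norm: "((x + 1) / q)\<^sup>2 + (y / q)\<^sup>2 = 1"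
    using q0 by (simp add: power_divide q2[symmetric] flip: add_divide_distrib)
  have s: "0 \<le> y / q"
    using d by (auto simp: q_def divide_simps)
  have "(x + 1) / q \<noteq> -1"
  proof
    assume *: "(x + 1) / q = -1"
    with norm have "y = 0" using q0 by simp
    moreover from * q0 have "x + 1 = - q" by (simp add: field_simps)
    ultimately show False
      using d by (auto simp: q_def split: if_splits)
  qed
  with norm s q0 show thesis
    by (intro that[of "(x + 1) / q" "y / q" q]) auto
qed

text \<open>With \<open>r = q - 2 * c\<close>, \<open>g\<close> becomes \<open>r\<^sup>2\<close>, so
  membership in \<open>S \<delta>\<close> turns into the bound on \<open>r\<close>.\<close>

lemma graph_f_polar:
  assumes "\<delta> > 0"
  shows "graph_f \<delta> = {(c * (2 * c + r) - 1, s * (2 * c + r), r * s) | c s r.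
    c\<^sup>2 + s\<^sup>2 = 1 \<and> 0 \<le> s \<and> c \<noteq> -1 \<and> \<bar>r\<bar> \<le> \<delta> \<and> 2 * c + r \<noteq> 0}" (is "_ = ?R")
proof (intro equalityI subsetI)
  fix p assume "p \<in> graph_f \<delta>"
  then obtain x y where p: "p = (x, y, f (x, y))" and xy: "(x, y) \<noteq> (-1, 0)" "g (x, y) \<le> \<delta>\<^sup>2"
    by (auto simp: graph_f_def S_def)
  obtain c s q where cs: "c\<^sup>2 + s\<^sup>2 = 1" "0 \<le> s" "c \<noteq> -1" and q: "q \<noteq> 0"
    and eq: "x = c * q - 1" "y = s * q"
    using polar_exists[OF xy(1)] .
  have "\<bar>q - 2 * c\<bar> \<le> \<delta>"
    using xy(2) assms polar_g_f(2)[OF cs(1) q] abs_le_square_iff[of "q - 2 * c" \<delta>] by (simp add: eq)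
  with cs q show "p \<in> ?R"
    unfolding p eq polar_g_f(3)[OF cs(1) q]
    by (intro CollectI exI[of _ c] exI[of _ s] exI[of _ "q - 2 * c"]) auto
next
  fix p assume "p \<in> ?R"
  then obtain c s r where p: "p = (c * (2 * c + r) - 1, s * (2 * c + r), r * s)"
    and cs: "c\<^sup>2 + s\<^sup>2 = 1" and r: "\<bar>r\<bar> \<le> \<delta>" and q: "2 * c + r \<noteq> 0"
    by blast
  have "r\<^sup>2 \<le> \<delta>\<^sup>2"
    using r assms abs_le_square_iff[of r \<delta>] by simp
  with polar_g_f[OF cs q] show "p \<in> graph_f \<delta>"
    unfolding p graph_f_def S_def by force
qed

text \<open>\<open>b\<close> is the bound \<delta>/2 on the modulus of \<open>c\<close>, capped at
  1/sqrt 2, where \<open>c\<^sup>2 * (1 - c\<^sup>2)\<close> peaks. The last claim says that the cap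
  is attained whenever it is active.\<close>

lemma b_bounds:
  assumes "\<delta> > 0"
  shows "0 < b \<delta>" "(b \<delta>)\<^sup>2 \<le> 1 / 2" "2 * b \<delta> \<le> \<delta>" "2 * b \<delta> < \<delta> \<Longrightarrow> (b \<delta>)\<^sup>2 = 1 / 2"
proof -
  show "0 < b \<delta>" "2 * b \<delta> \<le> \<delta>" "2 * b \<delta> < \<delta> \<Longrightarrow> (b \<delta>)\<^sup>2 = 1 / 2"
    using assms by (auto simp: b_def min_def power_divide split: if_splits)
  have "(b \<delta>)\<^sup>2 \<le> (sqrt 2 / 2)\<^sup>2"
    using assms by (intro power_mono) (auto simp: b_def)
  then show "(b \<delta>)\<^sup>2 \<le> 1 / 2"
    by (simp add: power_divide)
qed

lemma abs_le_\<sigma>_iff: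
  assumes "\<delta> > 0"
  shows "\<bar>z\<bar> \<le> \<sigma> \<delta> \<longleftrightarrow> z\<^sup>2 \<le> 4 * (b \<delta>)\<^sup>2 * (1 - (b \<delta>)\<^sup>2)"
proof -
  note b = b_bounds[OF assms]
  have "0 \<le> \<sigma> \<delta>" "(\<sigma> \<delta>)\<^sup>2 = 4 * (b \<delta>)\<^sup>2 * (1 - (b \<delta>)\<^sup>2)"
    using b(1,2) by (auto simp: \<sigma>_def power_mult_distrib)
  then show ?thesis
    using abs_le_square_iff[of z "\<sigma> \<delta>"] by simp
qed

lemma abs_double_product_le_\<sigma>:
  assumes "\<delta> > 0" "c\<^sup>2 + s\<^sup>2 = 1" "\<bar>2 * c\<bar> \<le> \<delta>"
  shows "\<bar>2 * c * s\<bar> \<le> \<sigma> \<delta>"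
proof -
  note b = b_bounds[OF assms(1)]
  let ?B = "(b \<delta>)\<^sup>2"
  \<comment> \<open>This product is
    \<open>?B * (1 - ?B) - c\<^sup>2 * (1 - c\<^sup>2)\<close>.\<close>
  have "0 \<le> (?B - c\<^sup>2) * (1 - ?B - c\<^sup>2)"
  proof (cases "\<bar>c\<bar> \<le> b \<delta>")
    case True
    then have "c\<^sup>2 \<le> ?B"
      using b(1) abs_le_square_iff[of c "b \<delta>"] by simp
    then show ?thesis
      using b(2) by (intro mult_nonneg_nonneg) auto
  next
    case False
    then have "?B = 1 / 2"
      using assms(3) by (intro b(4)) auto
    \<comment> \<open>Both factors are now \<open>1 / 2 - c\<^sup>2\<close>, so the product is a
      square.\<close>
    show ?thesis
      unfolding \<open>?B = 1 / 2\<close> by simp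
  qed
  moreover have "(2 * c * s)\<^sup>2 = 4 * c\<^sup>2 * (1 - c\<^sup>2)"
    using assms(2) by (auto simp: power_mult_distrib)
  ultimately have "(2 * c * s)\<^sup>2 \<le> 4 * ?B * (1 - ?B)"
    by (simp add: algebra_simps)
  then show ?thesis
    using abs_le_\<sigma>_iff[OF assms(1)] by simp
qed

text \<open>The squares of \<open>c\<close> and \<open>s\<close> are the two roots u of 4u(1 - u) =
  \<open>z\<^sup>2\<close>, namely (1 - R)/2 and (1 + R)/2. Giving \<open>c\<close> the smaller one
  meets the bound by \<delta> and leaves \<open>s\<close> positive, so \<open>c\<close> can be
  obtained by division.\<close>

lemma abs_le_\<sigma>_double_product:
  assumes "\<delta> > 0" "\<bar>z\<bar> \<le> \<sigma> \<delta>"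
  obtains c s where "c\<^sup>2 + s\<^sup>2 = 1" "0 < s" "\<bar>2 * c\<bar> \<le> \<delta>" "z = - 2 * c * s"
proof -
  note b = b_bounds[OF assms(1)]
  let ?B = "(b \<delta>)\<^sup>2"
  define R where "R = sqrt (1 - z\<^sup>2)"
  define s where "s = sqrt ((1 + R) / 2)"
  define c where "c = - z / (2 * s)"
  \<comment> \<open>Since \<open>1 - 4 * ?B * (1 - ?B)\<close> is the square of
    \<open>1 - 2 * ?B\<close>, the bound on \<open>z\<close> becomes a lower bound on
    \<open>R\<close>, which is \<open>c\<^sup>2\<close> \<le> \<open>?B\<close>.\<close>
  have "(1 - 2 * ?B)\<^sup>2 \<le> 1 - z\<^sup>2"
    using assms abs_le_\<sigma>_iff[of \<delta> z] by (simp add: power2_eq_square algebra_simps)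
  moreover from this have "0 \<le> 1 - z\<^sup>2"
    by (rule order_trans[OF zero_le_power2])
  ultimately have R: "1 - 2 * ?B \<le> R" "R\<^sup>2 = 1 - z\<^sup>2"
    by (auto simp: R_def intro: real_le_rsqrt)
  then have R0: "0 \<le> R"
    using b(2) by simp
  then have s: "0 < s" "s\<^sup>2 = (1 + R) / 2"
    by (auto simp: s_def)
  have "c\<^sup>2 = (1 - R\<^sup>2) / (2 * (1 + R))"
    using R0 by (simp add: c_def R(2) s(2) power_divide power_mult_distrib divide_simps)
  also have "\<dots> = (1 - R) / 2"
    using R0 by (simp add: divide_simps) (simp add: power2_eq_square algebra_simps)
  finally have c: "c\<^sup>2 = (1 - R) / 2" .
  then have "\<bar>c\<bar> \<le> b \<delta>"
    using R(1) b(1) abs_le_square_iff[of c "b \<delta>"] by simp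
  then have "\<bar>2 * c\<bar> \<le> \<delta>"
    using b(3) by simp
  moreover have "c\<^sup>2 + s\<^sup>2 = 1"
    unfolding c s(2) by (simp add: field_simps)
  moreover have "z = - 2 * c * s"
    using s(1) by (simp add: c_def)
  ultimately show thesis
    using that s(1) by blast
qed

lemma segment_polar:
  assumes "\<delta> > 0"
  shows "{(-1, 0, z) | z :: real. \<bar>z\<bar> \<le> \<sigma> \<delta>} =
    {(c * (2 * c + r) - 1, s * (2 * c + r), r * s) | c s r.
      c\<^sup>2 + s\<^sup>2 = 1 \<and> 0 \<le> s \<and> c \<noteq> -1 \<and> \<bar>r\<bar> \<le> \<delta> \<and> 2 * c + r = 0}" (is "?L = ?R")
proof (intro equalityI subsetI)
  fix p assume "p \<in> ?L"
  then obtain z where p: "p = (-1, 0, z)" and z: "\<bar>z\<bar> \<le> \<sigma> \<delta>"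
    by blast
  obtain c s where "c\<^sup>2 + s\<^sup>2 = 1" "0 < s" "\<bar>2 * c\<bar> \<le> \<delta>" "z = - 2 * c * s"
    using abs_le_\<sigma>_double_product[OF assms z] .
  \<comment> \<open>Strict positivity of \<open>s\<close> rules out \<open>c = -1\<close>.\<close>
  then show "p \<in> ?R"
    unfolding p by (intro CollectI exI[of _ c] exI[of _ s] exI[of _ "- 2 * c"]) auto
next
  fix p assume "p \<in> ?R"
  then obtain c s r where p: "p = (c * (2 * c + r) - 1, s * (2 * c + r), r * s)"
    and cs: "c\<^sup>2 + s\<^sup>2 = 1" and r: "\<bar>r\<bar> \<le> \<delta>" "2 * c + r = 0"
    by blast
  have req: "r = - 2 * c"
    using r(2) by simp
  then have "\<bar>2 * c * s\<bar> \<le> \<sigma> \<delta>"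
    using r(1) by (intro abs_double_product_le_\<sigma>[OF assms cs]) simp
  then show "p \<in> ?L"
    by (simp add: p req)
qed

theorem corollary1p6:
  fixes \<delta> :: real
  assumes "\<delta> > 0"
  shows "w ` P \<delta> = graph_f \<delta> \<union> {(-1, 0, z) | z :: real. \<bar>z\<bar> \<le> \<sigma> \<delta>}"
  \<comment> \<open>The two sets on the right split the image according to whether
    \<open>2 * c + r\<close> vanishes.\<close>
  unfolding w_image graph_f_polar[OF assms] segment_polar[OF assms] by blast

end
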